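(* Let $X$ be a compact Hausdorff space and let $\mu$ be a regular Borel probability measure on $X$ whose closed support is equal to $X$. Let $Y$ be the spectrum of $L^{\infty}(\mu)$, let $\Pi:Y\to X$ be the canonical projection, and let $\tilde\mu$ be the measure on $Y$ representing $\mu$. Let $h\in L^{\infty}(\mu)$, with Gelfand transform $\hat h\in C(Y)$. Then there exists an open dense subset $U$ of $Y$ with $\tilde\mu(U)=\tilde\mu(Y)$ such that $\hat h$ is constant on $\Pi^{-1}(\{x\})\cap U$ for all $x\in X$.
   Context: $C(X)$ is the algebra of complex-valued continuous functions on $X$. $L^{\infty}(\mu)$ is the commutative C*-algebra of $\mu$-equivalence classes $[f]$ of $\mu$-essentially bounded Borel measurable complex functions on $X$. $Y$ is its spectrum (the compact Hausdorff space of nonzero multiplicative linear functionals on $L^{\infty}(\mu)$ with the Gelfand, i.e. weak-star, topology), and $[f]\mapsto\widehat{[f]}\in C(Y)$ is the Gelfand transform, an isometric isomorphism of $L^{\infty}(\mu)$ onto $C(Y)$; one writes $\hat f$ for $\widehat{[f]}$. The projection $\Pi:Y\to X$: for $y\in Y$, the map $C(X)\ni f\mapsto\widehat{[f]}(y)$ is a multiplicative linear functional on $C(X)$, hence is evaluation at a unique point of $X$; this point is $\Pi(y)$. Thus $f(\Pi(y))=\widehat{[f]}(y)$ for all $f\in C(X)$. $\tilde\mu$ is the regular positive Borel measure on $Y$ given by the Riesz representation theorem such that $\|\tilde\mu\|=\|\mu\|$ and $\int_X f\,d\mu=\int_Y\hat f\,d\tilde\mu$ for all $f\in L^{\infty}(\mu)$.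 By convention, a function is regarded as constant on the empty set. *)

theory Defs
  imports "HOL-Analysis.Analysis" "HOL-Probability.Probability"
begin

definition borel_of :: "'a topology \<Rightarrow> 'a measure" where
  "borel_of T = sigma (topspace T) {U. openin T U}"

text \<open>The condition on \<^term>\<open>sets M\<close> also forces \<^term>\<open>space M = topspace T\<close>.\<close>

definition regular_borel_measure :: "'a topology \<Rightarrow> 'a measure \<Rightarrow> bool" where
  "regular_borel_measure T M \<longleftrightarrow>
     sets M = sets (borel_of T) \<and>
     (\<forall>A\<in>sets M. emeasure M A = (INF U\<in>{U. openin T U \<and> A \<subseteq> U}. emeasure M U)) \<and>
     (\<forall>A\<in>sets M. emeasure M A = (SUP K\<in>{K. compactin T K \<and> K \<subseteq> A}. emeasure M K))"

definition closed_support :: "'a topology \<Rightarrow> 'a measure \<Rightarrow> 'a set" where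
  "closed_support T M = topspace T - \<Union>{U. openin T U \<and> emeasure M U = 0}"

definition ess_bounded :: "'a measure \<Rightarrow> ('a \<Rightarrow> complex) set" where
  "ess_bounded M = {f \<in> borel_measurable M. \<exists>C. AE x in M. norm (f x) \<le> C}"

definition ae_class :: "'a measure \<Rightarrow> ('a \<Rightarrow> complex) \<Rightarrow> ('a \<Rightarrow> complex) set" where
  "ae_class M f = {g \<in> ess_bounded M. AE x in M. f x = g x}"

definition Linf :: "'a measure \<Rightarrow> ('a \<Rightarrow> complex) set set" where
  "Linf M = ae_class M ` ess_bounded M"

text \<open>The algebra operations on classes are those of representatives. Functionals are
  \<^term>\<open>undefined\<close> outside \<^term>\<open>Linf M\<close>, so that equality of functionals is equality
  on \<^term>\<open>Linf M\<close>.\<close>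

definition Linf_characters :: "'a measure \<Rightarrow> (('a \<Rightarrow> complex) set \<Rightarrow> complex) set" where
  "Linf_characters M = {\<phi> \<in> extensional (Linf M).
     (\<forall>f\<in>ess_bounded M. \<forall>g\<in>ess_bounded M.
        \<phi> (ae_class M (\<lambda>x. f x + g x)) = \<phi> (ae_class M f) + \<phi> (ae_class M g)) \<and>
     (\<forall>c. \<forall>f\<in>ess_bounded M. \<phi> (ae_class M (\<lambda>x. c * f x)) = c * \<phi> (ae_class M f)) \<and>
     (\<forall>f\<in>ess_bounded M. \<forall>g\<in>ess_bounded M.
        \<phi> (ae_class M (\<lambda>x. f x * g x)) = \<phi> (ae_class M f) * \<phi> (ae_class M g)) \<and>
     (\<exists>a\<in>Linf M. \<phi> a \<noteq> 0)}"

text \<open>The weak-star topology is the topology of pointwise convergence on \<^term>\<open>Linf M\<close>.\<close>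

definition Linf_spectrum :: "'a measure \<Rightarrow> (('a \<Rightarrow> complex) set \<Rightarrow> complex) topology" where
  "Linf_spectrum M =
     subtopology (product_topology (\<lambda>_. euclidean) (Linf M)) (Linf_characters M)"

definition gelfand :: "('a \<Rightarrow> complex) set \<Rightarrow> (('a \<Rightarrow> complex) set \<Rightarrow> complex) \<Rightarrow> complex" where
  "gelfand a = (\<lambda>\<phi>. \<phi> a)"

definition spectrum_proj ::
  "'a topology \<Rightarrow> 'a measure \<Rightarrow> (('a \<Rightarrow> complex) set \<Rightarrow> complex) \<Rightarrow> 'a" where
  "spectrum_proj X M y =
     (THE x. x \<in> topspace X \<and>
        (\<forall>f. continuous_map X euclidean f \<longrightarrow> f x = gelfand (ae_class M f) y))"

text \<open>The norm of a positive measure is its total mass. By the Riesz representation theorem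
  exactly one measure satisfies this predicate when \<^term>\<open>M\<close> is a finite measure.\<close>

definition represents_on_spectrum ::
  "'a measure \<Rightarrow> (('a \<Rightarrow> complex) set \<Rightarrow> complex) measure \<Rightarrow> bool" where
  "represents_on_spectrum M N \<longleftrightarrow>
     regular_borel_measure (Linf_spectrum M) N \<and>
     emeasure N (space N) = emeasure M (space M) \<and>
     (\<forall>f\<in>ess_bounded M. integral\<^sup>L M f = integral\<^sup>L N (gelfand (ae_class M f)))"

end

theory Submission
  imports Defs
begin

text \<open>The theorem is a form of Lusin's theorem. Let \<open>f\<close> represent \<open>h\<close>. There are compact
  sets \<open>K n\<close>, together exhausting the measure, on each of which \<open>f\<close> is continuous. In the
  spectrum, \<open>K n\<close> becomes the clopen set of the characters that take the value 1 on the
  indicator of \<open>K n\<close>, and \<open>U\<close> is the union of these sets. Such a character is a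
  multiplicative functional that only sees functions on \<open>K n\<close>, so on the functions
  continuous on \<open>K n\<close> it acts as evaluation at some point of \<open>K n\<close>
  (\<open>character_eq_evaluation_on_compact\<close>). Applied at once to \<open>f\<close> and to all continuous
  functions on the whole space, this shows that the point is the projection of the character
  and that the Gelfand transform of \<open>h\<close> agrees on \<open>U\<close> with \<open>f\<close> composed with the
  projection; in particular it is constant on the part of each fibre that lies in \<open>U\<close>.

  Everything about characters rests on one fact: the values of a character on finitely many
  functions lie in their joint essential range
  (\<open>character_joint_essential_range\<close>). Combined with compactness it gives the evaluation
  property above. It also shows that the clopen sets that come from sets of positive measure
  are small enough to fit into any nonempty open set, so that the measure on the spectrum,
  which gives such a clopen set the measure of the original set, charges every nonempty open
  set. Hence \<open>U\<close>, being open of full measure, is dense.\<close>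

section \<open>Essentially bounded functions and characters\<close>

lemma ess_boundedI:
  assumes "f \<in> borel_measurable M" "AE x in M. norm (f x) \<le> C"
  shows "f \<in> ess_bounded M"
  using assms unfolding ess_bounded_def by blast

lemma ess_bounded_measurable: "f \<in> ess_bounded M \<Longrightarrow> f \<in> borel_measurable M"
  unfolding ess_bounded_def by blast

lemma ess_bounded_const: "(\<lambda>x. c) \<in> ess_bounded M"
  by (rule ess_boundedI[where C = "norm c"]) auto

lemma ess_bounded_indicator:
  assumes "A \<in> sets M"
  shows "indicator A \<in> ess_bounded M"
  by (rule ess_boundedI[where C = 1]) (use assms in \<open>auto simp: indicator_def\<close>)

lemma ess_bounded_add:
  assumes "f \<in> ess_bounded M" "g \<in> ess_bounded M"
  shows "(\<lambda>x. f x + g x) \<in> ess_bounded M"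
proof -
  obtain B C where "AE x in M. norm (f x) \<le> B" "AE x in M. norm (g x) \<le> C"
    using assms unfolding ess_bounded_def by blast
  then have "AE x in M. norm (f x + g x) \<le> B + C"
    by eventually_elim (rule norm_triangle_mono)
  then show ?thesis
    using assms by (intro ess_boundedI[OF borel_measurable_add]) (simp_all add: ess_bounded_measurable)
qed

lemma ess_bounded_mult:
  assumes "f \<in> ess_bounded M" "g \<in> ess_bounded M"
  shows "(\<lambda>x. f x * g x) \<in> ess_bounded M"
proof -
  obtain B C where "AE x in M. norm (f x) \<le> B" "AE x in M. norm (g x) \<le> C"
    using assms unfolding ess_bounded_def by blast
  then have "AE x in M. norm (f x * g x) \<le> \<bar>B\<bar> * \<bar>C\<bar>"
    by eventually_elim (auto simp: norm_mult intro!: mult_mono)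
  then show ?thesis
    using assms by (intro ess_boundedI[OF borel_measurable_times]) (simp_all add: ess_bounded_measurable)
qed

lemma ess_bounded_cnj:
  assumes "f \<in> ess_bounded M"
  shows "(\<lambda>x. cnj (f x)) \<in> ess_bounded M"
proof -
  obtain C where "AE x in M. norm (f x) \<le> C"
    using assms unfolding ess_bounded_def by blast
  moreover have "(\<lambda>x. cnj (f x)) \<in> borel_measurable M"
    using ess_bounded_measurable[OF assms]
    by (rule borel_measurable_continuous_on[OF continuous_on_cnj[OF continuous_on_id]])
  ultimately show ?thesis
    by (intro ess_boundedI[where C = C]) auto
qed

lemma ess_bounded_inverse:
  assumes "f \<in> ess_bounded M" "d > 0" "AE x in M. d \<le> norm (f x)"
  shows "(\<lambda>x. inverse (f x)) \<in> ess_bounded M"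
proof (rule ess_boundedI)
  show "(\<lambda>x. inverse (f x)) \<in> borel_measurable M"
    using ess_bounded_measurable[OF assms(1)] by simp
  show "AE x in M. norm (inverse (f x)) \<le> inverse d"
    using assms(3) by eventually_elim (use \<open>d > 0\<close> in \<open>auto simp: norm_inverse intro!: le_imp_inverse_le\<close>)
qed

lemma ae_class_cong:
  assumes "AE x in M. f x = g x"
  shows "ae_class M f = ae_class M g"
proof -
  have "(AE x in M. f x = k x) \<longleftrightarrow> (AE x in M. g x = k x)" for k
    using assms by (intro eventually_cong) (auto elim: eventually_mono)
  then show ?thesis
    unfolding ae_class_def by auto
qed

lemma ae_class_in_Linf: "f \<in> ess_bounded M \<Longrightarrow> ae_class M f \<in> Linf M"
  unfolding Linf_def by blast

lemma Linf_representative: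
  assumes "a \<in> Linf M"
  obtains f where "f \<in> ess_bounded M" "a = ae_class M f"
  using assms unfolding Linf_def by blast

lemma character_add:
  "\<lbrakk>y \<in> Linf_characters M; f \<in> ess_bounded M; g \<in> ess_bounded M\<rbrakk> \<Longrightarrow>
     y (ae_class M (\<lambda>x. f x + g x)) = y (ae_class M f) + y (ae_class M g)"
  unfolding Linf_characters_def by blast

lemma character_scale:
  "\<lbrakk>y \<in> Linf_characters M; f \<in> ess_bounded M\<rbrakk> \<Longrightarrow>
     y (ae_class M (\<lambda>x. c * f x)) = c * y (ae_class M f)"
  unfolding Linf_characters_def by blast

lemma character_mult:
  "\<lbrakk>y \<in> Linf_characters M; f \<in> ess_bounded M; g \<in> ess_bounded M\<rbrakk> \<Longrightarrow>
     y (ae_class M (\<lambda>x. f x * g x)) = y (ae_class M f) * y (ae_class M g)"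
  unfolding Linf_characters_def by blast

lemma character_const:
  assumes y: "y \<in> Linf_characters M"
  shows "y (ae_class M (\<lambda>x. c)) = c"
proof -
  obtain a where "a \<in> Linf M" "y a \<noteq> 0"
    using y unfolding Linf_characters_def by blast
  then obtain f where f: "f \<in> ess_bounded M" "y (ae_class M f) \<noteq> 0"
    by (metis Linf_representative)
  have "y (ae_class M f) = y (ae_class M f) * y (ae_class M (\<lambda>x. 1))"
    using character_mult[OF y f(1) ess_bounded_const[of 1]] by simp
  then have "y (ae_class M (\<lambda>x. 1)) = 1"
    using f(2) by simp
  then show ?thesis
    using character_scale[OF y ess_bounded_const[of 1], of c] by simp
qed

lemma character_sum:
  assumes y: "y \<in> Linf_characters M" and "finite I" and "\<And>i. i \<in> I \<Longrightarrow> f i \<in> ess_bounded M"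
  shows "(\<lambda>x. \<Sum>i\<in>I. f i x) \<in> ess_bounded M \<and>
         y (ae_class M (\<lambda>x. \<Sum>i\<in>I. f i x)) = (\<Sum>i\<in>I. y (ae_class M (f i)))"
  using assms(2,3)
proof (induction I rule: finite_induct)
  case empty
  then show ?case
    using character_const[OF y, of 0] ess_bounded_const[of 0 M] by simp
next
  case (insert i I)
  then show ?case
    using character_add[OF y, of "f i" "\<lambda>x. \<Sum>i\<in>I. f i x"]
      ess_bounded_add[of "f i" M "\<lambda>x. \<Sum>i\<in>I. f i x"] by simp
qed

text \<open>A function bounded away from zero is invertible, and characters do not vanish
  on invertible elements.\<close>

lemma character_nonzero:
  assumes y: "y \<in> Linf_characters M" and f: "f \<in> ess_bounded M"
    and d: "d > 0" "AE x in M. d \<le> norm (f x)"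
  shows "y (ae_class M f) \<noteq> 0"
proof
  assume "y (ae_class M f) = 0"
  then have "y (ae_class M (\<lambda>x. f x * inverse (f x))) = 0"
    using character_mult[OF y f ess_bounded_inverse[OF f d]] by simp
  moreover have "AE x in M. f x * inverse (f x) = 1"
    using d(2) by eventually_elim (use d(1) in \<open>auto intro!: right_inverse\<close>)
  then have "y (ae_class M (\<lambda>x. f x * inverse (f x))) = 1"
    using ae_class_cong[of "\<lambda>x. f x * inverse (f x)" "\<lambda>x. 1" M] character_const[OF y, of 1] by simp
  ultimately show False
    by simp
qed

text \<open>If finitely many functions were almost everywhere not all close to their
  values under \<open>y\<close>, the sum of the squared absolute deviations would be bounded
  away from zero, hence invertible; but \<open>y\<close> annihilates it, since it
  annihilates one factor of each summand \<open>(f - y f) * cnj (f - y f)\<close>.\<close>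

lemma character_joint_essential_range:
  assumes y: "y \<in> Linf_characters M" and F: "finite F" "F \<subseteq> ess_bounded M"
    and d: "\<And>f. f \<in> F \<Longrightarrow> d f > 0"
  shows "\<not> (AE x in M. \<exists>f\<in>F. d f \<le> norm (f x - y (ae_class M f)))"
proof
  assume far: "AE x in M. \<exists>f\<in>F. d f \<le> norm (f x - y (ae_class M f))"
  define e where "e = Min (insert 1 (d ` F))"
  have e: "e > 0" "\<And>f. f \<in> F \<Longrightarrow> e \<le> d f"
    using F d by (auto simp: e_def)
  define dev where "dev f x = f x + - y (ae_class M f)" for f x
  define g where "g x = (\<Sum>f\<in>F. dev f x * cnj (dev f x))" for x
  have dev: "dev f \<in> ess_bounded M" "y (ae_class M (dev f)) = 0" if "f \<in> F" for f
  proof -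
    have "f \<in> ess_bounded M" using F that by auto
    then show "dev f \<in> ess_bounded M" "y (ae_class M (dev f)) = 0"
      using ess_bounded_add[of f M, OF _ ess_bounded_const[of "- y (ae_class M f)"]]
        character_add[OF y, of f, OF _ ess_bounded_const[of "- y (ae_class M f)"]]
        character_const[OF y, of "- y (ae_class M f)"] unfolding dev_def by simp_all
  qed
  have "y (ae_class M (\<lambda>x. dev f x * cnj (dev f x))) = 0" if "f \<in> F" for f
    using character_mult[OF y] dev[OF that] ess_bounded_cnj[of "dev f" M] by simp
  then have g: "g \<in> ess_bounded M" "y (ae_class M g) = 0"
    using character_sum[OF y F(1), of "\<lambda>f x. dev f x * cnj (dev f x)"]
      ess_bounded_mult[OF dev(1) ess_bounded_cnj[OF dev(1)]] unfolding g_def by simp_all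
  have "AE x in M. e\<^sup>2 \<le> norm (g x)"
    using far
  proof eventually_elim
    case (elim x)
    then obtain f where f: "f \<in> F" "e \<le> norm (dev f x)"
      unfolding dev_def using e(2) by force
    have "e\<^sup>2 \<le> (norm (dev f x))\<^sup>2"
      using f e(1) by (intro power_mono) auto
    also have "\<dots> \<le> (\<Sum>f\<in>F. (norm (dev f x))\<^sup>2)"
      using f F by (intro member_le_sum) auto
    also have "\<dots> = Re (g x)"
      by (simp add: g_def cmod_power2 flip: power2_eq_square)
    also have "\<dots> \<le> norm (g x)"
      by (rule complex_Re_le_cmod)
    finally show ?case .
  qed
  then show False
    using character_nonzero[OF y g(1), of "e\<^sup>2"] e(1) g(2) by simp
qed

section \<open>Clopen subsets of the spectrum\<close>

text \<open>The clopen set that corresponds to the idempotent class of the indicator of \<open>A\<close>: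
  the characters concentrated on \<open>A\<close>.\<close>

definition spectral_set :: "'a measure \<Rightarrow> 'a set \<Rightarrow> (('a \<Rightarrow> complex) set \<Rightarrow> complex) set" where
  "spectral_set M A = {y \<in> Linf_characters M. y (ae_class M (indicator A)) = 1}"

lemma spectral_set_subset: "spectral_set M A \<subseteq> Linf_characters M"
  by (auto simp: spectral_set_def)

lemma topspace_Linf_spectrum: "topspace (Linf_spectrum M) = Linf_characters M"
  by (auto simp: Linf_spectrum_def Linf_characters_def PiE_def)

text \<open>Indicators are idempotent, so characters take only the values 0 and 1 on
  them.\<close>

lemma character_indicator:
  assumes y: "y \<in> Linf_characters M" and A: "A \<in> sets M"
  shows "y (ae_class M (indicator A)) = indicator (spectral_set M A) y"
proof -
  have "(\<lambda>x. indicator A x * indicator A x) = (indicator A :: 'a \<Rightarrow> complex)"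
    by (auto simp: indicator_def)
  then have "y (ae_class M (indicator A)) * y (ae_class M (indicator A)) = y (ae_class M (indicator A))"
    using character_mult[OF y ess_bounded_indicator[OF A] ess_bounded_indicator[OF A]] by simp
  then have "y (ae_class M (indicator A)) = 0 \<or> y (ae_class M (indicator A)) = 1"
    by simp
  then show ?thesis
    using y by (auto simp: spectral_set_def indicator_def)
qed

text \<open>A value close to 1 forces the indicator of \<open>A\<close> to be 1, so adding
  this indicator to the list of functions localises the joint essential range to
  \<open>A\<close>.\<close>

lemma spectral_set_joint_essential_range:
  assumes y: "y \<in> spectral_set M A" and A: "A \<in> sets M"
    and F: "finite F" "F \<subseteq> ess_bounded M" and d: "d > 0"
  obtains x where "x \<in> A" "\<And>f. f \<in> F \<Longrightarrow> norm (f x - y (ae_class M f)) < d"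
proof -
  have y': "y \<in> Linf_characters M" "y (ae_class M (indicator A)) = 1"
    using y by (auto simp: spectral_set_def)
  have "\<not> (AE x in M. \<exists>f\<in>insert (indicator A) F. min 1 d \<le> norm (f x - y (ae_class M f)))"
    using F d ess_bounded_indicator[OF A]
    by (intro character_joint_essential_range[OF y'(1), where d = "\<lambda>_. min 1 d"]) auto
  then obtain x where "\<forall>f\<in>insert (indicator A) F. norm (f x - y (ae_class M f)) < min 1 d"
    by (metis (no_types, lifting) AE_I2 not_le)
  then show ?thesis
    using y'(2) by (intro that[of x]) (auto simp: indicator_def split: split_of_bool_asm)
qed

lemma spectral_set_openin:
  assumes A: "A \<in> sets M"
  shows "openin (Linf_spectrum M) (spectral_set M A)"
proof -
  let ?a = "ae_class M (indicator A)"
  have "?a \<in> Linf M"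
    using ae_class_in_Linf ess_bounded_indicator[OF A] by blast
  then have "continuous_map (Linf_spectrum M) euclidean (\<lambda>y. y ?a)"
    unfolding Linf_spectrum_def
    by (intro continuous_map_from_subtopology continuous_map_product_projection)
  then have "openin (Linf_spectrum M) {y \<in> topspace (Linf_spectrum M). y ?a \<in> - {0}}"
    by (rule openin_continuous_map_preimage) auto
  also have "{y \<in> topspace (Linf_spectrum M). y ?a \<in> - {0}} = spectral_set M A"
    using spectral_set_subset[of M A]
    by (auto simp: topspace_Linf_spectrum character_indicator[OF _ A] indicator_eq_0_iff)
  finally show ?thesis .
qed

lemma openin_in_sets:
  assumes "regular_borel_measure T M" "openin T U"
  shows "U \<in> sets M"
proof -
  have "{U. openin T U} \<subseteq> Pow (topspace T)"
    using openin_subset by blast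
  then show ?thesis
    using assms unfolding regular_borel_measure_def borel_of_def by (simp add: sets_measure_of sigma_sets.Basic)
qed

lemma space_regular_borel_measure:
  assumes "regular_borel_measure T M"
  shows "space M = topspace T"
proof -
  have "space (borel_of T) = topspace T"
    unfolding borel_of_def by (simp add: space_measure_of_conv)
  then show ?thesis
    using assms sets_eq_imp_space_eq unfolding regular_borel_measure_def by metis
qed

lemma integral_complex_indicator:
  assumes "A \<in> sets M"
  shows "integral\<^sup>L M (indicator A) = complex_of_real (measure M A)"
proof -
  have "(indicator A :: 'a \<Rightarrow> complex) = (\<lambda>x. complex_of_real (indicator A x))"
    by (auto simp: indicator_def)
  then show ?thesis
    using assms sets.sets_into_space[OF assms]
    by (simp only: integral_complex_of_real) (simp add: Int_absorb2)
qed

text \<open>On the spectrum, the Gelfand transform of the indicator of \<open>A\<close> is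
  the indicator of \<open>spectral_set M A\<close>, and integrals are preserved.\<close>

lemma emeasure_spectral_set:
  assumes M: "finite_measure M" and N: "represents_on_spectrum M N" and A: "A \<in> sets M"
  shows "emeasure N (spectral_set M A) = emeasure M A"
proof -
  interpret M: finite_measure M by (rule M)
  have reg: "regular_borel_measure (Linf_spectrum M) N"
    and total: "emeasure N (space N) = emeasure M (space M)"
    and int: "integral\<^sup>L M (indicator A :: _ \<Rightarrow> complex) = integral\<^sup>L N (gelfand (ae_class M (indicator A)))"
    using N ess_bounded_indicator[OF A] unfolding represents_on_spectrum_def by auto
  interpret N: finite_measure N
    using total by (intro finite_measureI) simp
  have sp: "space N = Linf_characters M"
    using space_regular_borel_measure[OF reg] by (simp add: topspace_Linf_spectrum)
  have meas: "spectral_set M A \<in> sets N"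
    using openin_in_sets[OF reg spectral_set_openin[OF A]] .
  have "integral\<^sup>L N (gelfand (ae_class M (indicator A))) = integral\<^sup>L N (indicator (spectral_set M A))"
    by (intro Bochner_Integration.integral_cong) (auto simp: gelfand_def sp character_indicator[OF _ A])
  then have "complex_of_real (measure M A) = complex_of_real (measure N (spectral_set M A))"
    using int by (simp only: integral_complex_indicator[OF A] integral_complex_indicator[OF meas])
  then show ?thesis
    by (simp add: M.emeasure_eq_measure N.emeasure_eq_measure)
qed

text \<open>A basic neighbourhood of \<open>y\<close> is given by finitely many functions
  and tolerances. The set \<open>A\<close> where these functions are within the tolerances
  of their values under \<open>y\<close> is not null, and every character concentrated on
  \<open>A\<close> satisfies the same estimates with \<open>\<le>\<close> in place of \<open><\<close>.\<close>

lemma spectral_sets_base: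
  assumes V: "openin (Linf_spectrum M) V" and y: "y \<in> V"
  obtains A where "A \<in> sets M" "emeasure M A > 0" "spectral_set M A \<subseteq> V"
proof -
  obtain W where W: "openin (product_topology (\<lambda>_. euclidean) (Linf M)) W" "V = W \<inter> Linf_characters M"
    using V unfolding Linf_spectrum_def openin_subtopology by blast
  have yc: "y \<in> Linf_characters M"
    using y W by blast
  have "y \<in> W"
    using y W by blast
  then obtain S where fin: "finite {a \<in> Linf M. S a \<noteq> (UNIV :: complex set)}"
    and S: "\<And>a. a \<in> Linf M \<Longrightarrow> open (S a)" "y \<in> Pi\<^sub>E (Linf M) S" "Pi\<^sub>E (Linf M) S \<subseteq> W"
    using bspec[OF W(1)[unfolded openin_product_topology_alt], of y] by auto
  define J where "J = {a \<in> Linf M. S a \<noteq> UNIV}"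
  have "\<forall>a\<in>J. \<exists>f. f \<in> ess_bounded M \<and> a = ae_class M f"
    using Linf_representative unfolding J_def by blast
  then obtain rep where rep: "\<And>a. a \<in> J \<Longrightarrow> rep a \<in> ess_bounded M \<and> a = ae_class M (rep a)"
    by metis
  define F where "F = rep ` J"
  have F: "finite F" "F \<subseteq> ess_bounded M"
    using fin rep unfolding F_def J_def[symmetric] by auto
  then have FJ: "\<And>f. f \<in> F \<Longrightarrow> ae_class M f \<in> Linf M"
    using ae_class_in_Linf by blast
  \<comment> \<open>Closed balls are used because the estimates of the values of other
    characters below are only non-strict.\<close>
  have "\<forall>f\<in>F. \<exists>e>0. cball (y (ae_class M f)) e \<subseteq> S (ae_class M f)"
    using S(1,2) FJ by (auto simp: PiE_iff open_contains_cball)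
  then obtain e where e: "\<And>f. f \<in> F \<Longrightarrow> e f > 0 \<and> cball (y (ae_class M f)) (e f) \<subseteq> S (ae_class M f)"
    by metis
  define A where "A = {x \<in> space M. \<forall>f\<in>F. norm (f x - y (ae_class M f)) < e f}"
  have "{x \<in> space M. norm (f x - y (ae_class M f)) < e f} \<in> sets M" if "f \<in> F" for f
  proof -
    have "f \<in> borel_measurable M" using that F ess_bounded_measurable by blast
    then show ?thesis by measurable
  qed
  then have A: "A \<in> sets M"
    unfolding A_def using F(1) by (intro sets.sets_Collect_finite_All) auto
  show thesis
  proof (rule that[OF A])
    have "\<not> (AE x in M. x \<notin> A)"
    proof
      assume "AE x in M. x \<notin> A"
      then have "AE x in M. \<exists>f\<in>F. e f \<le> norm (f x - y (ae_class M f))"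
        using AE_space by eventually_elim (auto simp: A_def not_less)
      then show False
        using character_joint_essential_range[OF yc F] e by blast
    qed
    then show "emeasure M A > 0"
      using AE_iff_null_sets[OF A] A by (auto simp: null_sets_def zero_less_iff_neq_zero)
    show "spectral_set M A \<subseteq> V"
    proof
      fix z assume z: "z \<in> spectral_set M A"
      then have zc: "z \<in> Linf_characters M"
        by (simp add: spectral_set_def)
      have near: "z (ae_class M f) \<in> S (ae_class M f)" if f: "f \<in> F" for f
      proof -
        have "norm (z (ae_class M f) - y (ae_class M f)) \<le> e f"
        proof (rule field_le_epsilon)
          fix r :: real assume "r > 0"
          then obtain x where "x \<in> A" "norm (f x - z (ae_class M f)) < r"
            using spectral_set_joint_essential_range[OF z A, of "{f}" r] f F(2) by auto
          moreover from this have "norm (f x - y (ae_class M f)) < e f"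
            using f by (auto simp: A_def)
          ultimately show "norm (z (ae_class M f) - y (ae_class M f)) \<le> e f + r"
            using norm_triangle_ineq4[of "f x - y (ae_class M f)" "f x - z (ae_class M f)"] by simp
        qed
        then show ?thesis
          using e[OF f] by (auto simp: subset_eq dist_norm norm_minus_commute)
      qed
      have "z a \<in> S a" if a: "a \<in> Linf M" for a
        using near[of "rep a"] rep[of a] a by (cases "a \<in> J") (auto simp: F_def J_def)
      moreover have "z \<in> extensional (Linf M)"
        using zc unfolding Linf_characters_def by blast
      ultimately show "z \<in> V"
        using S(3) zc W(2) by (auto simp: PiE_def)
    qed
  qed
qed

text \<open>A nonempty open set contains a clopen set of positive measure, so it cannot be
  disjoint from \<open>U\<close>.\<close>

lemma full_measure_open_dense:
  assumes M: "finite_measure M" and N: "represents_on_spectrum M N"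
    and U: "openin (Linf_spectrum M) U"
    and full: "emeasure N U = emeasure N (topspace (Linf_spectrum M))"
  shows "Linf_spectrum M closure_of U = topspace (Linf_spectrum M)"
proof -
  have reg: "regular_borel_measure (Linf_spectrum M) N"
    and total: "emeasure N (space N) = emeasure M (space M)"
    using N unfolding represents_on_spectrum_def by auto
  interpret M: finite_measure M by (rule M)
  interpret N: finite_measure N
    using total by (intro finite_measureI) simp
  have "U \<inter> V \<noteq> {}" if V: "openin (Linf_spectrum M) V" "V \<noteq> {}" for V
  proof
    assume disj: "U \<inter> V = {}"
    obtain A where A: "A \<in> sets M" "emeasure M A > 0" "spectral_set M A \<subseteq> V"
      using V spectral_sets_base by blast
    note [measurable] = openin_in_sets[OF reg U] openin_in_sets[OF reg V(1)]
    have "0 < emeasure N V"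
      using A emeasure_spectral_set[OF M N A(1)] emeasure_mono[OF A(3), of N]
        openin_in_sets[OF reg V(1)] by (metis leD not_gr_zero)
    moreover have "emeasure N U + emeasure N V = emeasure N (U \<union> V)"
      using disj by (intro plus_emeasure) auto
    moreover have "emeasure N (U \<union> V) \<le> emeasure N (space N)"
      by (rule emeasure_space)
    ultimately show False
      using full space_regular_borel_measure[OF reg]
      by (simp add: N.emeasure_eq_measure measure_nonneg flip: ennreal_plus)
  qed
  then show ?thesis
    using openin_subset[OF U] unfolding dense_intersects_open by (auto simp: closure_of_eq_topspace)
qed

section \<open>Characters as evaluations\<close>

lemma continuous_imp_ess_bounded:
  assumes X: "compact_space X" and M: "regular_borel_measure X M"
    and f: "continuous_map X euclidean f"
  shows "f \<in> ess_bounded M"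
proof -
  have sp: "space M = topspace X"
    by (rule space_regular_borel_measure[OF M])
  have meas: "f \<in> borel_measurable M"
  proof (rule borel_measurableI)
    fix S :: "complex set" assume "open S"
    then have "openin X {x \<in> topspace X. f x \<in> S}"
      using f by (intro openin_continuous_map_preimage) auto
    also have "{x \<in> topspace X. f x \<in> S} = f -` S \<inter> space M"
      using sp by auto
    finally show "f -` S \<inter> space M \<in> sets M"
      by (rule openin_in_sets[OF M])
  qed
  have "compact (f ` topspace X)"
    using image_compactin[OF _ f] X by (simp add: compact_space_def)
  then obtain C where "\<And>x. x \<in> topspace X \<Longrightarrow> norm (f x) \<le> C"
    using compact_imp_bounded bounded_iff by (metis imageI)
  then show ?thesis
    using sp meas by (intro ess_boundedI[where C = C]) auto
qed

text \<open>The sets of points of \<open>K\<close> where \<open>f\<close> is within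
  \<open>d\<close> of its value under \<open>y\<close> are closed in \<open>K\<close>.
  Finitely many of them have a common point by the joint essential range, hence by
  compactness all of them do.\<close>

lemma character_eq_evaluation_on_compact:
  assumes K: "compactin X K" "K \<in> sets M" and y: "y \<in> spectral_set M K"
    and F: "F \<subseteq> ess_bounded M"
    and cont: "\<And>f. f \<in> F \<Longrightarrow> continuous_map (subtopology X K) euclidean f"
  obtains x where "x \<in> K" "\<And>f. f \<in> F \<Longrightarrow> f x = y (ae_class M f)"
proof -
  define C where "C f d = {x \<in> topspace (subtopology X K). f x \<in> cball (y (ae_class M f)) d}" for f d
  \<comment> \<open>Adding \<open>K\<close> itself keeps the intersection inside
    \<open>K\<close> even when \<open>F\<close> is empty.\<close>
  define \<U> where "\<U> = insert K ((\<lambda>(f, d). C f d) ` (F \<times> {0<..}))"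
  have top: "topspace (subtopology X K) = K"
    using compactin_subset_topspace[OF K(1)] by auto
  have "compact_space (subtopology X K)"
    using K(1) compact_space_subtopology by blast
  moreover have "\<forall>D\<in>\<U>. closedin (subtopology X K) D"
  proof -
    have "closedin (subtopology X K) (C f d)" if "f \<in> F" for f d
      unfolding C_def using cont[OF that] by (intro closedin_continuous_map_preimage) auto
    moreover have "closedin (subtopology X K) K"
      using closedin_topspace[of "subtopology X K"] unfolding top .
    ultimately show ?thesis by (auto simp: \<U>_def)
  qed
  moreover have "\<forall>\<F>. finite \<F> \<and> \<F> \<subseteq> \<U> \<longrightarrow> \<Inter>\<F> \<noteq> {}"
  proof (intro allI impI)
    fix \<F> assume \<F>: "finite \<F> \<and> \<F> \<subseteq> \<U>"
    then have "finite (\<F> - {K})" "\<F> - {K} \<subseteq> (\<lambda>(f, d). C f d) ` (F \<times> {0<..})"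
      by (auto simp: \<U>_def)
    then obtain P where P: "finite P" "P \<subseteq> F \<times> {0<..}" "\<F> - {K} = (\<lambda>(f, d). C f d) ` P"
      by (metis finite_subset_image)
    define r where "r = Min (insert 1 (snd ` P))"
    have r: "r > 0" "\<And>f d. (f, d) \<in> P \<Longrightarrow> r \<le> d"
      using P(1,2) unfolding r_def by (auto intro!: Min_le) force
    have "finite (fst ` P)" "fst ` P \<subseteq> ess_bounded M"
      using P(1,2) F by auto
    then obtain x where x: "x \<in> K" "\<And>f. f \<in> fst ` P \<Longrightarrow> norm (f x - y (ae_class M f)) < r"
      using spectral_set_joint_essential_range[OF y K(2) _ _ r(1), of "fst ` P"] by auto
    have "x \<in> C f d" if "(f, d) \<in> P" for f d
      using x(1) x(2)[of f] r(2)[OF that] that unfolding C_def top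
      by (force simp: dist_norm norm_minus_commute)
    then have "x \<in> \<Inter>(insert K (\<F> - {K}))"
      using x(1) unfolding P(3) by auto
    then show "\<Inter>\<F> \<noteq> {}" by blast
  qed
  ultimately have "\<Inter>\<U> \<noteq> {}"
    unfolding compact_space_fip by blast
  then obtain x where x: "x \<in> \<Inter>\<U>" by blast
  show thesis
  proof (rule that)
    show "x \<in> K" using x by (auto simp: \<U>_def)
    fix f assume f: "f \<in> F"
    have "dist (f x) (y (ae_class M f)) \<le> 0"
    proof (rule field_le_epsilon)
      fix d :: real assume "d > 0"
      then have "x \<in> C f d" using x f by (auto simp: \<U>_def)
      then show "dist (f x) (y (ae_class M f)) \<le> 0 + d"
        by (simp add: C_def dist_commute)
    qed
    then show "f x = y (ae_class M f)" by simp
  qed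
qed

lemma continuous_functions_separate_points:
  assumes X: "compact_space X" "Hausdorff_space X"
    and "x \<in> topspace X" "z \<in> topspace X"
    and eq: "\<And>f :: 'a \<Rightarrow> complex. continuous_map X euclidean f \<Longrightarrow> f x = f z"
  shows "x = z"
proof (rule ccontr)
  assume "x \<noteq> z"
  have "closedin X {x}" "closedin X {z}"
    using assms(3,4) X(2) by (auto intro: closedin_Hausdorff_singleton)
  moreover have "normal_space X"
    using X compact_Hausdorff_or_regular_imp_normal_space by blast
  ultimately obtain f :: "'a \<Rightarrow> real" where f: "continuous_map X (top_of_set {0..1}) f" "f ` {x} \<subseteq> {0}" "f ` {z} \<subseteq> {1}"
    using Urysohn_lemma[of X "{x}" "{z}" 0 1] \<open>x \<noteq> z\<close> by auto
  then have "continuous_map X euclidean f"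
    by (simp add: continuous_map_in_subtopology)
  then have "continuous_map X euclidean (\<lambda>t. complex_of_real (f t))"
    using continuous_map_compose[of X euclidean f euclidean complex_of_real]
      continuous_on_of_real[OF continuous_on_id]
    by (simp add: o_def)
  then show False
    using eq[of "\<lambda>t. complex_of_real (f t)"] f(2,3) by simp
qed

text \<open>The projection is defined by a definite description; uniqueness of the point
  comes from Urysohn's lemma.\<close>

lemma spectrum_proj_eqI:
  assumes "compact_space X" "Hausdorff_space X" and "x \<in> topspace X"
    and "\<And>f. continuous_map X euclidean f \<Longrightarrow> f x = y (ae_class M f)"
  shows "spectrum_proj X M y = x"
  unfolding spectrum_proj_def gelfand_def
proof (rule the_equality)
  show "z = x" if "z \<in> topspace X \<and> (\<forall>f. continuous_map X euclidean f \<longrightarrow> f z = y (ae_class M f))" for z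
    using that assms by (intro continuous_functions_separate_points[of X]) auto
qed (use assms in auto)

section \<open>Lusin's theorem for regular Borel measures\<close>

lemma compactin_in_sets:
  assumes "regular_borel_measure T M" "Hausdorff_space T" "compactin T K"
  shows "K \<in> sets M"
proof -
  have "topspace T - K \<in> sets M"
    by (rule openin_in_sets[OF assms(1) openin_diff[OF openin_topspace compactin_imp_closedin[OF assms(2,3)]]])
  then have "space M - (topspace T - K) \<in> sets M"
    by blast
  also have "space M - (topspace T - K) = K"
    using compactin_subset_topspace[OF assms(3)] space_regular_borel_measure[OF assms(1)] by auto
  finally show ?thesis .
qed

lemma regular_borel_measure_inner_approx:
  assumes M: "finite_measure M" "regular_borel_measure T M" and T: "Hausdorff_space T"
    and A: "A \<in> sets M" and "e > 0"
  obtains K where "compactin T K" "K \<subseteq> A" "measure M (A - K) < e"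
proof -
  interpret finite_measure M by (rule M(1))
  let ?\<K> = "{K. compactin T K \<and> K \<subseteq> A}"
  have sup: "emeasure M A = (SUP K\<in>?\<K>. emeasure M K)"
    using M(2) A unfolding regular_borel_measure_def by blast
  have "{} \<in> ?\<K>"
    by simp
  then obtain K where K: "compactin T K" "K \<subseteq> A" "emeasure M A < emeasure M K + ennreal e"
    using SUP_approx_ennreal[OF \<open>e > 0\<close> _ sup] by auto
  have "K \<in> sets M"
    using compactin_in_sets[OF M(2) T K(1)] .
  then have "measure M (A - K) = measure M A - measure M K"
    using A K(2) by (intro finite_measure_Diff)
  also have "measure M A < measure M K + e"
    using K(3) \<open>e > 0\<close> by (simp add: emeasure_eq_measure ennreal_less_iff flip: ennreal_plus)
  finally show thesis
    using that K by simp
qed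

text \<open>Approximate the preimage of each basic open set, and its complement, from
  inside by compact sets. On the intersection over all basic sets of the unions of these
  pairs, each preimage is the complement of a compact set, hence relatively open.\<close>

theorem Lusin:
  fixes f :: "'a \<Rightarrow> 'b::second_countable_topology"
  assumes M: "finite_measure M" "regular_borel_measure T M" and T: "Hausdorff_space T"
    and f: "f \<in> borel_measurable M" and "e > 0"
  obtains K where "compactin T K" "measure M (space M - K) < e"
    "continuous_map (subtopology T K) euclidean f"
proof -
  interpret finite_measure M by (rule M(1))
  obtain \<B> :: "'b set set" where \<B>: "countable \<B>" "topological_basis \<B>"
    using ex_countable_basis by blast
  \<comment> \<open>The empty set is added so that the enumerated family is
    nonempty.\<close>
  define B where "B = from_nat_into (insert {} \<B>)"
  have range_B: "range B = insert {} \<B>"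
    unfolding B_def using \<B>(1) by (intro range_from_nat_into) auto
  have open_B: "open (B n)" for n
    using range_B \<B>(2) topological_basis_open by (metis insertE open_empty rangeI)
  define A where "A n = f -` B n \<inter> space M" for n
  have A: "A n \<in> sets M" for n
    unfolding A_def using f open_B by (intro measurable_sets) auto
  \<comment> \<open>For each basic set, two errors below \<open>d n\<close> occur, so
    the total error is at most \<open>2 * (e / 4)\<close>, strictly below
    \<open>e\<close>.\<close>
  define d :: "nat \<Rightarrow> real" where "d n = e / 4 * (1/2) ^ Suc n" for n
  have d: "d n > 0" for n
    using \<open>e > 0\<close> by (simp add: d_def)
  have "\<exists>K. compactin T K \<and> K \<subseteq> A n \<and> measure M (A n - K) < d n" for n
    using regular_borel_measure_inner_approx[OF M T A d] by blast
  then obtain K where K: "\<And>n. compactin T (K n)" "\<And>n. K n \<subseteq> A n" "\<And>n. measure M (A n - K n) < d n"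
    by metis
  have "\<exists>L. compactin T L \<and> L \<subseteq> space M - A n \<and> measure M ((space M - A n) - L) < d n" for n
    using regular_borel_measure_inner_approx[OF M T sets.compl_sets[OF A] d] by blast
  then obtain L where L: "\<And>n. compactin T (L n)" "\<And>n. L n \<subseteq> space M - A n"
      "\<And>n. measure M ((space M - A n) - L n) < d n"
    by metis
  note [measurable] = A compactin_in_sets[OF M(2) T K(1)] compactin_in_sets[OF M(2) T L(1)]
  define C where "C = (\<Inter>n. K n \<union> L n)"
  have "closedin T C"
    unfolding C_def using K(1) L(1) T
    by (intro closedin_Inter) (auto intro!: closedin_Un intro: compactin_imp_closedin)
  moreover have "C \<subseteq> K 0 \<union> L 0"
    by (auto simp: C_def)
  ultimately have compact: "compactin T C"
    using K(1) L(1) by (meson closed_compactin compactin_Un)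
  have small: "measure M (space M - (K n \<union> L n)) \<le> 2 * d n" for n
  proof -
    have "space M - (K n \<union> L n) = (A n - K n) \<union> ((space M - A n) - L n)"
      using K(2)[of n] L(2)[of n] unfolding A_def by blast
    then have "measure M (space M - (K n \<union> L n)) \<le> measure M (A n - K n) + measure M ((space M - A n) - L n)"
      by (simp add: measure_Un_le)
    then show ?thesis
      using K(3)[of n] L(3)[of n] by simp
  qed
  have sums: "(\<lambda>n. 2 * d n) sums (e / 2)"
    using sums_mult[OF power_half_series, of "e / 2"] by (simp add: d_def)
  have summable: "summable (\<lambda>n. measure M (space M - (K n \<union> L n)))"
    by (rule summable_comparison_test'[OF sums_summable[OF sums], of 0]) (use small in auto)
  have "measure M (space M - C) = measure M (\<Union>n. space M - (K n \<union> L n))"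
    by (simp add: C_def)
  also have "\<dots> \<le> (\<Sum>n. measure M (space M - (K n \<union> L n)))"
    by (rule finite_measure_subadditive_countably[OF _ summable]) auto
  also have "\<dots> \<le> e / 2"
    using suminf_le[OF small summable sums_summable[OF sums]] sums_unique[OF sums] by simp
  also have "\<dots> < e"
    using \<open>e > 0\<close> by simp
  finally have meas: "measure M (space M - C) < e" .
  have top: "topspace (subtopology T C) = C"
    using compactin_subset_topspace[OF compact] by auto
  have basic: "openin (subtopology T C) {x \<in> C. f x \<in> B n}" for n
  proof -
    have "{x \<in> C. f x \<in> B n} = C - L n"
      using K(2)[of n] L(2)[of n] by (auto simp: C_def A_def)
    moreover have "closedin (subtopology T C) (C \<inter> L n)"
      using compactin_imp_closedin[OF T L(1)] by (simp add: closedin_subtopology_Int_closed)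
    ultimately show ?thesis
      using openin_diff[OF openin_topspace[of "subtopology T C"], of "C \<inter> L n"]
      unfolding top by (simp add: Diff_Int)
  qed
  have "continuous_map (subtopology T C) euclidean f"
    unfolding continuous_map_def
  proof (intro conjI allI impI)
    fix S :: "'b set" assume "openin euclidean S"
    then obtain \<B>' where \<B>': "\<B>' \<subseteq> \<B>" "S = \<Union>\<B>'"
      using \<B>(2) unfolding topological_basis_def by (metis open_openin)
    have "\<exists>n. D = B n" if "D \<in> \<B>'" for D
    proof -
      have "D \<in> range B"
        using that \<B>'(1) unfolding range_B by blast
      then show ?thesis by blast
    qed
    then have "S = (\<Union>n\<in>{n. B n \<in> \<B>'}. B n)"
      unfolding \<B>'(2) by blast
    then have "{x \<in> topspace (subtopology T C). f x \<in> S} = (\<Union>n\<in>{n. B n \<in> \<B>'}. {x \<in> C. f x \<in> B n})"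
      unfolding top by auto
    then show "openin (subtopology T C) {x \<in> topspace (subtopology T C). f x \<in> S}"
      using basic by (auto intro!: openin_Union)
  qed auto
  then show thesis
    using that compact meas by blast
qed

section \<open>Constancy on fibres\<close>

theorem theorem1:
  fixes X :: "'a topology" and \<mu> :: "'a measure"
    and \<mu>' :: "(('a \<Rightarrow> complex) set \<Rightarrow> complex) measure"
    and h :: "('a \<Rightarrow> complex) set"
  assumes "compact_space X" and "Hausdorff_space X"
    and "regular_borel_measure X \<mu>" and "prob_space \<mu>"
    and "closed_support X \<mu> = topspace X"
    and "represents_on_spectrum \<mu> \<mu>'"
    and "h \<in> Linf \<mu>"
  shows "\<exists>U. openin (Linf_spectrum \<mu>) U \<and>
           Linf_spectrum \<mu> closure_of U = topspace (Linf_spectrum \<mu>) \<and>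
           emeasure \<mu>' U = emeasure \<mu>' (topspace (Linf_spectrum \<mu>)) \<and>
           (\<forall>x\<in>topspace X. gelfand h constant_on
              ({y \<in> topspace (Linf_spectrum \<mu>). spectrum_proj X \<mu> y = x} \<inter> U))"
proof -
  interpret prob_space \<mu> by (rule assms(4))
  have fin: "finite_measure \<mu>"
    by (rule finite_measure_axioms)
  obtain f where f: "f \<in> ess_bounded \<mu>" "h = ae_class \<mu> f"
    using Linf_representative[OF assms(7)] .
  have "\<exists>K. compactin X K \<and> measure \<mu> (space \<mu> - K) < 1 / Suc n \<and>
      continuous_map (subtopology X K) euclidean f" for n
    using Lusin[OF fin assms(3,2) ess_bounded_measurable[OF f(1)], of "1 / Suc n"] by auto
  then obtain K where K: "\<And>n. compactin X (K n)" "\<And>n. measure \<mu> (space \<mu> - K n) < 1 / Suc n"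
      "\<And>n. continuous_map (subtopology X (K n)) euclidean f"
    by metis
  have K_sets: "K n \<in> sets \<mu>" for n
    using compactin_in_sets[OF assms(3,2) K(1)] .
  define U where "U = (\<Union>n. spectral_set \<mu> (K n))"
  have U: "openin (Linf_spectrum \<mu>) U"
    unfolding U_def using spectral_set_openin[OF K_sets] by (intro openin_Union) auto
  have reg: "regular_borel_measure (Linf_spectrum \<mu>) \<mu>'"
    and total: "emeasure \<mu>' (space \<mu>') = 1"
    using assms(6) emeasure_space_1 unfolding represents_on_spectrum_def by auto
  have sp: "space \<mu>' = topspace (Linf_spectrum \<mu>)"
    by (rule space_regular_borel_measure[OF reg])
  have full: "emeasure \<mu>' U = emeasure \<mu>' (topspace (Linf_spectrum \<mu>))"
  proof (rule antisym)
    show "emeasure \<mu>' U \<le> emeasure \<mu>' (topspace (Linf_spectrum \<mu>))"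
      using emeasure_space[of \<mu>' U] sp by simp
    have "ennreal (1 - 1 / Suc n) \<le> emeasure \<mu>' U" for n
    proof -
      have "1 - 1 / Suc n \<le> measure \<mu> (K n)"
        using K(2)[of n] prob_compl[OF K_sets] by simp
      then have "ennreal (1 - 1 / Suc n) \<le> emeasure \<mu> (K n)"
        by (simp add: emeasure_eq_measure ennreal_leI)
      also have "\<dots> = emeasure \<mu>' (spectral_set \<mu> (K n))"
        using emeasure_spectral_set[OF fin assms(6) K_sets] by simp
      also have "\<dots> \<le> emeasure \<mu>' U"
        using openin_in_sets[OF reg U] by (intro emeasure_mono) (auto simp: U_def)
      finally show ?thesis .
    qed
    moreover have "(\<lambda>n. ennreal (1 - 1 / Suc n)) \<longlonglongrightarrow> ennreal 1"
      using tendsto_diff[OF tendsto_const[of 1] LIMSEQ_inverse_real_of_nat]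
      by (intro tendsto_ennrealI) (simp add: inverse_eq_divide)
    ultimately have "ennreal 1 \<le> emeasure \<mu>' U"
      by (intro LIMSEQ_le_const2) auto
    then show "emeasure \<mu>' (topspace (Linf_spectrum \<mu>)) \<le> emeasure \<mu>' U"
      using total sp by simp
  qed
  have factors: "gelfand h y = f (spectrum_proj X \<mu> y)" if "y \<in> U" for y
  proof -
    obtain n where n: "y \<in> spectral_set \<mu> (K n)"
      using \<open>y \<in> U\<close> by (auto simp: U_def)
    \<comment> \<open>The continuous functions identify the point as the projection of
      \<open>y\<close>; including \<open>f\<close> in the same family gives its value at that
      very point.\<close>
    let ?F = "insert f {g. continuous_map X euclidean g}"
    have "?F \<subseteq> ess_bounded \<mu>"
      using f(1) continuous_imp_ess_bounded[OF assms(1,3)] by auto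
    moreover have "continuous_map (subtopology X (K n)) euclidean g" if "g \<in> ?F" for g
      using that K(3) by (auto intro: continuous_map_from_subtopology)
    ultimately obtain x where x: "x \<in> K n" "\<And>g. g \<in> ?F \<Longrightarrow> g x = y (ae_class \<mu> g)"
      using character_eq_evaluation_on_compact[OF K(1) K_sets n] by metis
    have "spectrum_proj X \<mu> y = x"
      using x compactin_subset_topspace[OF K(1)] by (intro spectrum_proj_eqI[OF assms(1,2)]) auto
    then show ?thesis
      using x(2)[of f] f(2) by (simp add: gelfand_def)
  qed
  show ?thesis
  proof (intro exI[of _ U] conjI ballI)
    fix x
    show "gelfand h constant_on ({y \<in> topspace (Linf_spectrum \<mu>). spectrum_proj X \<mu> y = x} \<inter> U)"
      unfolding constant_on_def by (intro exI[of _ "f x"]) (auto simp: factors)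
  qed (rule U full full_measure_open_dense[OF fin assms(6) U full])+
qed

end
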